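(* Let $X$ be a real Hausdorff locally convex topological vector space, let $F\subset X$ be a convex set with $0\in\operatorname{int}(F)$, and let $\Omega$ be a nonempty convex subset of $X$. Suppose that $\bar x\notin\mathrm{cl}_F(\Omega)$, and let $r:=\mathcal{T}^F_{\Omega}(\bar x)>0$. Then $$\partial\mathcal{T}^F_{\Omega}(\bar x)=N(\bar x;\Omega_r)\cap S^*,\qquad\text{where } S^*:=\{x^*\in X^*\mid\sigma_F(-x^* )=1\}$$ and $\Omega_r:=\{x\in X\mid\mathcal{T}^F_{\Omega}(x)\le r\}$.
   Context: $X^*$ is the topological dual of $X$, with pairing $\langle x^*,x\rangle=x^*(x)$. The minimal time function with target $\Omega$ and dynamics $F$ is $\mathcal{T}_{\Omega}^F(x):=\inf\{t>0\mid (x+tF)\cap\Omega\neq\emptyset\}$, $x\in X$ (it is real-valued when $0\in\operatorname{int}(F)$ and $\Omega\ne\emptyset$). The $F$-closure of $\Omega$ is $\mathrm{cl}_F(\Omega):=\bigcap_{\varepsilon>0}(\Omega-\varepsilon F)$; $\mathcal{T}^F_\Omega(x)>0$ exactly when $x\notin\mathrm{cl}_F(\Omega)$. The support function of $F$ is $\sigma_F(x^* ):=\sup\{\langle x^*,f\rangle\mid f\in F\}\in(-\infty,\infty]$. For a convex set $A\subset X$ and $\bar x\in A$, the normal cone is $N(\bar x;A):=\{x^*\in X^*\mid \langle x^*,x-\bar x\rangle\le 0\text{ for all }x\in A\}$. For a convex function $\varphi:X\to(-\infty,\infty]$ and $\bar x$ with $\varphi(\bar x)<\infty$, $\partial\varphi(\bar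 x):=\{x^*\in X^*\mid\langle x^*,x-\bar x\rangle\le\varphi(x)-\varphi(\bar x)\text{ for all }x\in X\}$. *)

theory Defs
  imports "HOL-Analysis.Analysis"
begin

text \<open>
  Real Hausdorff locally convex topological vector spaces.  Joint continuity of addition and
  continuity of negation come from \<^class>\<open>topological_ab_group_add\<close>.  The second axiom is a
  base of convex open neighbourhoods of the origin; \<^const>\<open>convex\<close> is unfolded there because a
  class specification cannot mention it, see \<open>convex_nhds_base_0\<close> below.
\<close>

class real_locally_convex_space = real_vector + topological_ab_group_add + t2_space +
  assumes tendsto_scaleR_Pair:
    "filterlim (\<lambda>p. fst p *\<^sub>R snd p) (nhds (a *\<^sub>R x)) (nhds a \<times>\<^sub>F nhds x)"
  assumes convex_nhds_base_0_raw:
    "open U \<Longrightarrow> 0 \<in> U \<Longrightarrow> \<exists>V. open V \<and>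
      (\<forall>x\<in>V. \<forall>y\<in>V. \<forall>u\<ge>0. \<forall>v\<ge>0. u + v = 1 \<longrightarrow> u *\<^sub>R x + v *\<^sub>R y \<in> V) \<and> 0 \<in> V \<and> V \<subseteq> U"

lemma convex_nhds_base_0:
  fixes U :: "'a::real_locally_convex_space set"
  assumes "open U" "0 \<in> U"
  shows "\<exists>V. open V \<and> convex V \<and> 0 \<in> V \<and> V \<subseteq> U"
  using convex_nhds_base_0_raw[OF assms] unfolding convex_def .

instance real_normed_vector \<subseteq> real_locally_convex_space
proof
  fix a :: real and x :: 'a
  show "filterlim (\<lambda>p. fst p *\<^sub>R snd p) (nhds (a *\<^sub>R x)) (nhds a \<times>\<^sub>F nhds x)"
    by (intro tendsto_scaleR filterlim_fst filterlim_snd)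
next
  fix U :: "'a set"
  assume "open U" "0 \<in> U"
  then obtain e where "e > 0" "ball 0 e \<subseteq> U"
    by (meson openE)
  then show "\<exists>V. open V \<and>
      (\<forall>x\<in>V. \<forall>y\<in>V. \<forall>u\<ge>0. \<forall>v\<ge>0. u + v = 1 \<longrightarrow> u *\<^sub>R x + v *\<^sub>R y \<in> V) \<and> 0 \<in> V \<and> V \<subseteq> U"
    unfolding convex_def[symmetric]
    by (intro exI[of _ "ball 0 e"]) auto
qed

definition topological_dual :: "('a::real_locally_convex_space \<Rightarrow> real) set" where
  "topological_dual = {xs. linear xs \<and> continuous_on UNIV xs}"

text \<open>Extended-real valued: the infimum of the empty set is \<open>\<infinity>\<close>.\<close>

definition minimal_time ::
    "'a::real_locally_convex_space set \<Rightarrow> 'a set \<Rightarrow> 'a \<Rightarrow> ereal" where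
  "minimal_time F \<Omega> x = Inf {ereal t | t. 0 < t \<and> (\<lambda>f. x + t *\<^sub>R f) ` F \<inter> \<Omega> \<noteq> {}}"

definition F_closure ::
    "'a::real_locally_convex_space set \<Rightarrow> 'a set \<Rightarrow> 'a set" where
  "F_closure F \<Omega> = (\<Inter>\<epsilon>\<in>{0::real<..}. {w - \<epsilon> *\<^sub>R f | w f. w \<in> \<Omega> \<and> f \<in> F})"

definition support_function ::
    "'a::real_locally_convex_space set \<Rightarrow> ('a \<Rightarrow> real) \<Rightarrow> ereal" where
  "support_function F xs = (SUP f\<in>F. ereal (xs f))"

text \<open>Meant for convex \<open>A\<close> and \<open>x \<in> A\<close>.\<close>

definition normal_cone ::
    "'a::real_locally_convex_space \<Rightarrow> 'a set \<Rightarrow> ('a \<Rightarrow> real) set" where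
  "normal_cone x A = {xs \<in> topological_dual. \<forall>a\<in>A. xs (a - x) \<le> 0}"

text \<open>Meant for convex \<open>\<phi>\<close> that do not take the value \<open>-\<infinity>\<close>, at points \<open>x\<close> with \<open>\<phi> x < \<infinity>\<close>.\<close>

definition subdifferential ::
    "('a::real_locally_convex_space \<Rightarrow> ereal) \<Rightarrow> 'a \<Rightarrow> ('a \<Rightarrow> real) set" where
  "subdifferential \<phi> x = {xs \<in> topological_dual. \<forall>y. ereal (xs (y - x)) \<le> \<phi> y - \<phi> x}"

end

(* Moving from x by -u f with f in F raises the minimal time by at most u, while moving along an
   almost optimal direction f by u lowers it by about u.  For the inclusion from right to left,
   a point y is transported into the sublevel set of level r by such a move with
   u = |T y - r|; the normal cone inequality there, combined with the values of -xs on F having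
   supremum 1, is the subgradient inequality at y. *)
theory Submission
  imports Defs
begin

section \<open>Absorption and scaling for a set around the origin\<close>

lemma eventually_scaleR_mem_open:
  fixes v :: "'a::real_locally_convex_space"
  assumes "open U" "0 \<in> U"
  shows "\<forall>\<^sub>F a in nhds (0::real). a *\<^sub>R v \<in> U"
proof -
  have "filterlim (\<lambda>a. (a, v)) (nhds 0 \<times>\<^sub>F nhds v) (nhds (0::real))"
    by (intro filterlim_Pair filterlim_ident tendsto_const)
  from filterlim_compose[OF tendsto_scaleR_Pair this]
  have "((\<lambda>a. a *\<^sub>R v) \<longlongrightarrow> 0) (nhds (0::real))" by simp
  then show ?thesis using assms by (rule topological_tendstoD)
qed

lemma absorbing_interior_0:
  fixes v :: "'a::real_locally_convex_space"
  assumes "0 \<in> interior F"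
  obtains t where "t > 0" "v \<in> (*\<^sub>R) t ` F"
proof -
  have "\<forall>\<^sub>F a in nhds (0::real). a *\<^sub>R v \<in> interior F"
    by (rule eventually_scaleR_mem_open) (use assms in auto)
  then obtain d where d: "d > 0" "\<And>a. dist a 0 < d \<Longrightarrow> a *\<^sub>R v \<in> interior F"
    unfolding eventually_nhds_metric by blast
  \<comment> \<open>Any scalar strictly within distance \<open>d\<close> of 0 would do;
    \<open>d/2\<close> is one, and its inverse becomes the dilation factor.\<close>
  have "(d/2) *\<^sub>R v \<in> F"
    using d(2)[of "d/2"] \<open>d > 0\<close> interior_subset[of F] by auto
  then have "v \<in> (*\<^sub>R) (2/d) ` F"
    using \<open>d > 0\<close> by (auto intro!: image_eqI[where x = "(d/2) *\<^sub>R v"])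
  with \<open>d > 0\<close> show ?thesis by (intro that[of "2/d"]) auto
qed

text \<open>The dilations of a convex set containing 0 increase with the factor, because
  \<open>(s/t) *\<^sub>R f\<close> lies on the segment from 0 to \<open>f\<close>.\<close>

lemma convex_scaleR_mem_mono:
  fixes F :: "'a::real_vector set"
  assumes "convex F" "0 \<in> F" "f \<in> F" "0 \<le> s" "s \<le> t" "0 < t"
  obtains g where "g \<in> F" "s *\<^sub>R f = t *\<^sub>R g"
proof
  show "(s/t) *\<^sub>R f \<in> F"
    using convexD_alt[OF assms(1-3), of "s/t"] assms(4-6) by simp
  show "s *\<^sub>R f = t *\<^sub>R ((s/t) *\<^sub>R f)" using assms(6) by simp
qed

section \<open>Estimates for the minimal time function\<close>

lemma minimal_time_le:
  assumes "0 < t" "f \<in> F" "x + t *\<^sub>R f \<in> \<Omega>"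
  shows "minimal_time F \<Omega> x \<le> ereal t"
  unfolding minimal_time_def by (rule Inf_lower) (use assms in blast)

lemma minimal_time_nonneg: "0 \<le> minimal_time F \<Omega> x"
  unfolding minimal_time_def by (rule Inf_greatest) auto

text \<open>The infimum only yields an admissible time \<open>s\<close> below \<open>t\<close>;
  monotonicity of the dilations of \<open>F\<close> makes \<open>t\<close> itself
  admissible.\<close>

lemma minimal_time_lessE:
  assumes "convex F" "0 \<in> F" "minimal_time F \<Omega> x < ereal t"
  obtains f where "0 < t" "f \<in> F" "x + t *\<^sub>R f \<in> \<Omega>"
proof -
  obtain s f where s: "0 < s" "s < t" "f \<in> F" "x + s *\<^sub>R f \<in> \<Omega>"
    using assms(3) unfolding minimal_time_def Inf_less_iff by auto
  obtain g where "g \<in> F" "s *\<^sub>R f = t *\<^sub>R g"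
    by (rule convex_scaleR_mem_mono[OF assms(1,2) s(3), of s t]) (use s in auto)
  with s show ?thesis by (intro that[of g]) auto
qed

text \<open>As \<open>F\<close> is absorbing, some dilation of it reaches from \<open>x\<close> to
  any chosen point of \<Omega>.\<close>

lemma minimal_time_finite:
  assumes "0 \<in> interior F" "\<Omega> \<noteq> {}"
  shows "\<bar>minimal_time F \<Omega> x\<bar> \<noteq> \<infinity>"
proof -
  obtain w where "w \<in> \<Omega>" using assms(2) by blast
  obtain t where t: "t > 0" "w - x \<in> (*\<^sub>R) t ` F"
    using absorbing_interior_0[OF assms(1)] .
  then obtain f where "f \<in> F" "w - x = t *\<^sub>R f" by blast
  then have "minimal_time F \<Omega> x \<le> ereal t"
    using t(1) \<open>w \<in> \<Omega>\<close> by (intro minimal_time_le[of t f]) (auto simp: algebra_simps)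
  with minimal_time_nonneg[of F \<Omega> x] show ?thesis by auto
qed

lemma minimal_time_eq_0:
  assumes "0 \<in> F" "w \<in> \<Omega>"
  shows "minimal_time F \<Omega> w = 0"
proof (rule antisym[OF _ minimal_time_nonneg])
  show "minimal_time F \<Omega> w \<le> 0"
    \<comment> \<open>With the direction 0 the point \<open>w\<close> stays in \<Omega>, so every
      positive time is admissible.\<close>
    by (rule ereal_le_epsilon2)
      (use minimal_time_le[of _ 0 F w \<Omega>] assms in \<open>auto simp: zero_ereal_def\<close>)
qed

text \<open>Some time \<open>e\<close> is not admissible for \<open>x\<close>. All times above the
  minimal one are, so the minimal time is at least \<open>e\<close>.\<close>

lemma minimal_time_pos:
  assumes "convex F" "0 \<in> F" "x \<notin> F_closure F \<Omega>"
  shows "0 < minimal_time F \<Omega> x"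
proof -
  obtain e where e: "e > 0" "\<And>w f. w \<in> \<Omega> \<Longrightarrow> f \<in> F \<Longrightarrow> x \<noteq> w - e *\<^sub>R f"
    using assms(3) unfolding F_closure_def by auto
  have "\<not> minimal_time F \<Omega> x < ereal e"
    using minimal_time_lessE[OF assms(1,2)] e(2) by (metis add_diff_cancel)
  with e(1) show ?thesis
    by (meson ereal_less(2) less_le_trans not_less)
qed

text \<open>A journey from the shifted point can first undo the shift in time \<open>u\<close> and
  then follow a route from \<open>x\<close>; convexity merges the two legs into a single
  direction.\<close>

lemma minimal_time_diff_scaleR_le:
  assumes "convex F" "0 \<in> F" "f \<in> F" "0 \<le> u"
  shows "minimal_time F \<Omega> (x - u *\<^sub>R f) \<le> minimal_time F \<Omega> x + ereal u"
proof -
  \<comment> \<open>The infimum at \<open>x\<close> need not be attained, so the bound is checked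
    against every value strictly above it.\<close>
  have "minimal_time F \<Omega> (x - u *\<^sub>R f) - ereal u \<le> minimal_time F \<Omega> x"
  proof (rule dense_ge)
    fix s' assume less: "minimal_time F \<Omega> x < s'"
    show "minimal_time F \<Omega> (x - u *\<^sub>R f) - ereal u \<le> s'"
    proof (cases s')
      case (real s)
      obtain g where g: "0 < s" "g \<in> F" "x + s *\<^sub>R g \<in> \<Omega>"
        using minimal_time_lessE[OF assms(1,2)] less real by blast
      \<comment> \<open>The average of the two directions, weighted by the time spent in
        each.\<close>
      define h where "h = (u/(u+s)) *\<^sub>R f + (s/(u+s)) *\<^sub>R g"
      have h: "h \<in> F"
        unfolding h_def using assms g(1,2)
        by (intro convexD[OF assms(1)]) (auto simp flip: add_divide_distrib)
      have "(u+s) *\<^sub>R h = u *\<^sub>R f + s *\<^sub>R g"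
        unfolding h_def using assms(4) g(1) by (simp add: scaleR_add_right)
      then have "x - u *\<^sub>R f + (u+s) *\<^sub>R h \<in> \<Omega>" using g(3) by simp
      then have "minimal_time F \<Omega> (x - u *\<^sub>R f) \<le> ereal (u+s)"
        using h g(1) assms(4) by (intro minimal_time_le) auto
      then show ?thesis
        using real by (cases "minimal_time F \<Omega> (x - u *\<^sub>R f)") auto
    qed (use less minimal_time_nonneg[of F \<Omega> x] in auto)
  qed
  then show ?thesis
    by (simp add: ereal_minus_le)
qed

section \<open>Subgradients, normals and the support function\<close>

lemma support_function_eq_1_iff:
  "support_function F xs = 1 \<longleftrightarrow>
    (\<forall>f\<in>F. xs f \<le> 1) \<and> (\<forall>c<1. \<exists>f\<in>F. c < xs f)"
proof
  assume *: "support_function F xs = 1"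
  show "(\<forall>f\<in>F. xs f \<le> 1) \<and> (\<forall>c<1. \<exists>f\<in>F. c < xs f)"
  proof (intro conjI ballI allI impI)
    fix f assume "f \<in> F"
    then have "ereal (xs f) \<le> 1"
      unfolding *[symmetric] support_function_def by (rule SUP_upper)
    then show "xs f \<le> 1" by simp
  next
    fix c :: real assume "c < 1"
    then have "ereal c < support_function F xs" using * by simp
    then show "\<exists>f\<in>F. c < xs f"
      unfolding support_function_def less_SUP_iff by simp
  qed
next
  assume *: "(\<forall>f\<in>F. xs f \<le> 1) \<and> (\<forall>c<1. \<exists>f\<in>F. c < xs f)"
  show "support_function F xs = 1"
  proof (rule antisym)
    show "support_function F xs \<le> 1"
      unfolding support_function_def using * by (intro SUP_least) auto
    show "1 \<le> support_function F xs"
    proof (rule dense_le)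
      fix c :: ereal assume c: "c < 1"
      show "c \<le> support_function F xs"
      proof (cases c)
        case (real c')
        then obtain f where "f \<in> F" "c' < xs f" using * c by auto
        then show ?thesis
          unfolding support_function_def real by (intro SUP_upper2[of f]) auto
      qed (use c in auto)
    qed
  qed
qed

text \<open>The upper bound comes from the subgradient inequality at \<open>xbar - f\<close>, the
  approximation of 1 from the inequality at a point of \<Omega> reached in almost minimal
  time.\<close>

lemma subgradient_support_function:
  assumes "convex F" "0 \<in> F" "linear xs"
    and T: "minimal_time F \<Omega> xbar = ereal \<rho>" "0 < \<rho>"
    and sub: "\<And>y. ereal (xs (y - xbar)) \<le> minimal_time F \<Omega> y - ereal \<rho>"
  shows "support_function F (\<lambda>x. - xs x) = 1"
  unfolding support_function_eq_1_iff
proof (intro conjI ballI allI impI)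
  interpret linear xs by fact
  fix f assume f: "f \<in> F"
  have "ereal (xs (- f)) \<le> minimal_time F \<Omega> (xbar - 1 *\<^sub>R f) - ereal \<rho>"
    using sub[of "xbar - 1 *\<^sub>R f"] by simp
  also have "\<dots> \<le> ereal (\<rho> + 1) - ereal \<rho>"
    using minimal_time_diff_scaleR_le[OF assms(1,2) f, of 1 \<Omega> xbar] T
    by (intro ereal_minus_mono) auto
  finally show "- xs f \<le> 1" by (simp add: neg)
next
  interpret linear xs by fact
  fix c :: real assume "c < 1"
  \<comment> \<open>Raising \<open>c\<close> to a positive number makes the time
    \<open>\<rho> / d\<close> below meaningful.\<close>
  define c' where "c' = max c (1/2)"
  have c': "0 < c'" "c' < 1" "c \<le> c'" using \<open>c < 1\<close> by (auto simp: c'_def)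
  \<comment> \<open>A midpoint: \<open>d < 1\<close> puts \<open>\<rho> / d\<close> strictly above
    the minimal time, and \<open>c' < d\<close> makes the final inequality strict.\<close>
  define d where "d = (c' + 1) / 2"
  have d: "0 < d" "d < 1" "c' < d" using c' by (auto simp: d_def)
  have "minimal_time F \<Omega> xbar < ereal (\<rho> / d)"
    using T d by (simp add: field_simps)
  then obtain f where f: "f \<in> F" "xbar + (\<rho>/d) *\<^sub>R f \<in> \<Omega>"
    using minimal_time_lessE[OF assms(1,2)] by blast
  have "ereal (xs ((\<rho>/d) *\<^sub>R f)) \<le> 0 - ereal \<rho>"
    using sub[of "xbar + (\<rho>/d) *\<^sub>R f"] minimal_time_eq_0[OF assms(2) f(2)] by simp
  then have "\<rho> / d * xs f \<le> - \<rho>" by (simp add: scale)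
  then have "\<rho> * d \<le> \<rho> * (- xs f)" using d(1) by (simp add: field_simps)
  then have "d \<le> - xs f" using T(2) by (simp only: mult_le_cancel_left_pos)
  with f(1) d(3) c'(3) show "\<exists>f\<in>F. c < - xs f" by (intro bexI[of _ f]) auto
qed

lemma normal_imp_subgradient:
  assumes "convex F" "0 \<in> F" "linear xs"
    and \<rho>: "0 < \<rho>"
    and normal: "\<And>a. minimal_time F \<Omega> a \<le> ereal \<rho> \<Longrightarrow> xs (a - xbar) \<le> 0"
    and supp: "support_function F (\<lambda>x. - xs x) = 1"
    and \<tau>: "minimal_time F \<Omega> y = ereal \<tau>"
  shows "xs (y - xbar) \<le> \<tau> - \<rho>"
proof (cases "\<tau> < \<rho>")
  interpret linear xs by fact
  case True
  \<comment> \<open>Here \<open>y\<close> has time to spare: stepping back along \<open>f\<close>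
    for \<open>\<rho> - \<tau>\<close> stays in the sublevel set. The supremum 1 need not be
    attained, hence the limit over \<open>c\<close>.\<close>
  have "c \<le> xs (xbar - y) / (\<rho> - \<tau>)" if c: "c < 1" for c
  proof -
    obtain f where f: "f \<in> F" "c < - xs f"
      using supp c unfolding support_function_eq_1_iff by blast
    have "minimal_time F \<Omega> (y - (\<rho> - \<tau>) *\<^sub>R f) \<le> ereal \<rho>"
      using minimal_time_diff_scaleR_le[OF assms(1,2) f(1), of "\<rho> - \<tau>" \<Omega> y] True \<tau> by simp
    from normal[OF this] have "(\<rho> - \<tau>) * (- xs f) \<le> xs (xbar - y)"
      by (simp add: diff scale)
    then have "- xs f \<le> xs (xbar - y) / (\<rho> - \<tau>)"
      using True by (simp add: field_simps)
    with f(2) show ?thesis by simp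
  qed
  then have "1 \<le> xs (xbar - y) / (\<rho> - \<tau>)" by (rule dense_le)
  then show ?thesis using True by (simp add: field_simps diff)
next
  interpret linear xs by fact
  case False
  \<comment> \<open>Here \<open>y\<close> may be too far away: on a route to \<Omega> lasting
    \<open>t\<close>, travelling for \<open>t - \<rho>\<close> leaves time \<open>\<rho>\<close>, so
    that intermediate point is in the sublevel set.\<close>
  have "xs (y - xbar) + \<rho> \<le> t" if t: "\<tau> < t" for t
  proof -
    obtain f where f: "f \<in> F" "y + t *\<^sub>R f \<in> \<Omega>"
      using minimal_time_lessE[OF assms(1,2), of \<Omega> y t] t \<tau> by auto
    have "y + (t - \<rho>) *\<^sub>R f + \<rho> *\<^sub>R f \<in> \<Omega>"
      using f(2) by (simp add: algebra_simps)
    then have "minimal_time F \<Omega> (y + (t - \<rho>) *\<^sub>R f) \<le> ereal \<rho>"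
      by (rule minimal_time_le[OF \<rho> f(1)])
    from normal[OF this] have "xs (y - xbar) \<le> (t - \<rho>) * (- xs f)"
      by (simp add: diff add scale)
    also have "\<dots> \<le> (t - \<rho>) * 1"
      using supp f(1) False t unfolding support_function_eq_1_iff
      by (intro mult_left_mono) auto
    finally show ?thesis by simp
  qed
  then have "xs (y - xbar) + \<rho> \<le> \<tau>" by (rule dense_ge)
  then show ?thesis by simp
qed

theorem theorem4p5:
  fixes F \<Omega> :: "'a::real_locally_convex_space set" and xbar :: 'a and r :: ereal
  assumes "convex F" and "0 \<in> interior F"
    and "convex \<Omega>" and "\<Omega> \<noteq> {}"
    and "xbar \<notin> F_closure F \<Omega>"
    and "r = minimal_time F \<Omega> xbar"
  shows "0 < r \<and>
    subdifferential (minimal_time F \<Omega>) xbar =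
      normal_cone xbar {x. minimal_time F \<Omega> x \<le> r} \<inter>
      {xs \<in> topological_dual. support_function F (\<lambda>x. - xs x) = 1}"
proof -
  have F0: "0 \<in> F" using assms(2) interior_subset by blast
  have "0 < r" using minimal_time_pos[OF assms(1) F0 assms(5)] assms(6) by simp
  obtain \<rho> where r: "r = ereal \<rho>"
    using minimal_time_finite[OF assms(2,4)] assms(6) by (metis ereal_real')
  have T: "minimal_time F \<Omega> xbar = ereal \<rho>" and \<rho>: "0 < \<rho>"
    using r assms(6) \<open>0 < r\<close> by auto
  \<comment> \<open>Both sides of the claimed equality lie in the dual, so comparing membership of
    dual elements suffices.\<close>
  have "xs \<in> subdifferential (minimal_time F \<Omega>) xbar \<longleftrightarrow>
      xs \<in> normal_cone xbar {x. minimal_time F \<Omega> x \<le> r} \<and>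
      support_function F (\<lambda>x. - xs x) = 1" if xs: "xs \<in> topological_dual" for xs
  proof -
    have lin: "linear xs" using xs by (simp add: topological_dual_def)
    show ?thesis
    proof
      assume "xs \<in> subdifferential (minimal_time F \<Omega>) xbar"
      then have sub: "ereal (xs (y - xbar)) \<le> minimal_time F \<Omega> y - ereal \<rho>" for y
        by (simp add: subdifferential_def T)
      have "xs (a - xbar) \<le> 0" if "minimal_time F \<Omega> a \<le> ereal \<rho>" for a
        using sub[of a] that by (cases "minimal_time F \<Omega> a") auto
      then show "xs \<in> normal_cone xbar {x. minimal_time F \<Omega> x \<le> r} \<and>
          support_function F (\<lambda>x. - xs x) = 1"
        using subgradient_support_function[OF assms(1) F0 lin T \<rho> sub] xs
        by (simp add: normal_cone_def r)
    next
      assume *: "xs \<in> normal_cone xbar {x. minimal_time F \<Omega> x \<le> r} \<and>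
          support_function F (\<lambda>x. - xs x) = 1"
      have "ereal (xs (y - xbar)) \<le> minimal_time F \<Omega> y - ereal \<rho>" for y
      proof -
        obtain \<tau> where \<tau>: "minimal_time F \<Omega> y = ereal \<tau>"
          using minimal_time_finite[OF assms(2,4)] by (metis ereal_real')
        have "xs (y - xbar) \<le> \<tau> - \<rho>"
          using * by (intro normal_imp_subgradient[OF assms(1) F0 lin \<rho> _ _ \<tau>])
            (auto simp: normal_cone_def r)
        with \<tau> show ?thesis by simp
      qed
      with xs show "xs \<in> subdifferential (minimal_time F \<Omega>) xbar"
        by (simp add: subdifferential_def T)
    qed
  qed
  with \<open>0 < r\<close> show ?thesis
    by (auto simp: subdifferential_def normal_cone_def)
qed

end
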